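(* For all positive integers $d,n\ge 4$ the variety $N(d,n)$ of all $d$-tuples of commuting nilpotent $n\times n$ matrices over $\mathbb{F}$ is reducible.
   Context: $\mathbb{F}$ is an algebraically closed field of arbitrary characteristic. $N(d,n)\subseteq M_n(\mathbb{F})^d\cong\mathbb{F}^{dn^2}$ is the set of all $d$-tuples $(A_1,\ldots,A_d)$ of pairwise commuting nilpotent $n\times n$ matrices over $\mathbb{F}$, with the Zariski topology. "Variety" means a Zariski closed subset of an affine space (not necessarily irreducible); reducible means not irreducible as a topological space. *)

theory Defs
  imports
    "HOL-Analysis.Abstract_Topology"
    "HOL-Computational_Algebra.Polynomial"
    "Jordan_Normal_Form.Matrix"
begin

definition mat_tuples :: "nat \<Rightarrow> nat \<Rightarrow> 'a mat list set" where
  "mat_tuples d n = {As. length As = d \<and> set As \<subseteq> carrier_mat n n}"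

text \<open>
  The functions given by polynomials in the \<open>d n\<^sup>2\<close> matrix entries. They are total functions on
  lists of matrices, but only their values on \<^const>\<open>mat_tuples\<close> matter.
\<close>

inductive_set polynomial_functions :: "nat \<Rightarrow> nat \<Rightarrow> ('a::field mat list \<Rightarrow> 'a) set"
  for d n :: nat where
  const: "(\<lambda>_. c) \<in> polynomial_functions d n"
| coord: "k < d \<Longrightarrow> i < n \<Longrightarrow> j < n \<Longrightarrow> (\<lambda>As. (As ! k) $$ (i, j)) \<in> polynomial_functions d n"
| add: "p \<in> polynomial_functions d n \<Longrightarrow> q \<in> polynomial_functions d n \<Longrightarrow>
    (\<lambda>As. p As + q As) \<in> polynomial_functions d n"
| mult: "p \<in> polynomial_functions d n \<Longrightarrow> q \<in> polynomial_functions d n \<Longrightarrow>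
    (\<lambda>As. p As * q As) \<in> polynomial_functions d n"

definition zero_locus ::
    "nat \<Rightarrow> nat \<Rightarrow> ('a::field mat list \<Rightarrow> 'a) set \<Rightarrow> 'a mat list set" where
  "zero_locus d n P = {As \<in> mat_tuples d n. \<forall>p\<in>P. p As = 0}"

definition zariski_closed :: "nat \<Rightarrow> nat \<Rightarrow> 'a::field mat list set \<Rightarrow> bool" where
  "zariski_closed d n Z \<longleftrightarrow> (\<exists>P \<subseteq> polynomial_functions d n. Z = zero_locus d n P)"

definition zariski_topology :: "nat \<Rightarrow> nat \<Rightarrow> 'a::field mat list topology" where
  "zariski_topology d n =
     topology (\<lambda>U. U \<subseteq> mat_tuples d n \<and> zariski_closed d n (mat_tuples d n - U))"

lemma zariski_closed_Un:
  assumes "zariski_closed d n Y" "zariski_closed d n Z"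
  shows "zariski_closed d n (Y \<union> Z)"
proof -
  obtain P Q where P: "P \<subseteq> polynomial_functions d n" "Y = zero_locus d n P"
    and Q: "Q \<subseteq> polynomial_functions d n" "Z = zero_locus d n Q"
    using assms unfolding zariski_closed_def by blast
  define R where "R = {(\<lambda>As. p As * q As) |p q. p \<in> P \<and> q \<in> Q}"
  have "R \<subseteq> polynomial_functions d n"
    using P Q by (auto simp: R_def intro: polynomial_functions.mult)
  moreover have "Y \<union> Z = zero_locus d n R"
  proof
    show "Y \<union> Z \<subseteq> zero_locus d n R"
      by (auto simp: P(2) Q(2) zero_locus_def R_def)
    show "zero_locus d n R \<subseteq> Y \<union> Z"
    proof
      fix As assume As: "As \<in> zero_locus d n R"
      have "p As * q As = 0" if "p \<in> P" "q \<in> Q" for p q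
      proof -
        have "\<forall>f\<in>R. f As = 0"
          using As by (simp add: zero_locus_def)
        moreover have "(\<lambda>As. p As * q As) \<in> R"
          using that by (auto simp: R_def)
        ultimately show ?thesis by (rule bspec)
      qed
      then have "(\<forall>p\<in>P. p As = 0) \<or> (\<forall>q\<in>Q. q As = 0)"
        by (meson mult_eq_0_iff)
      then show "As \<in> Y \<union> Z"
        using As by (auto simp: P(2) Q(2) zero_locus_def)
    qed
  qed
  ultimately show ?thesis
    unfolding zariski_closed_def by (intro exI[of _ R] conjI)
qed

lemma zariski_closed_Inter:
  assumes "\<And>Z. Z \<in> \<Z> \<Longrightarrow> zariski_closed d n Z"
  shows "zariski_closed d n (mat_tuples d n \<inter> \<Inter>\<Z>)"
proof -
  have "\<exists>P. \<forall>Z\<in>\<Z>. P Z \<subseteq> polynomial_functions d n \<and> Z = zero_locus d n (P Z)"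
    by (intro bchoice ballI) (use assms in \<open>simp add: zariski_closed_def\<close>)
  then obtain P where
    "\<forall>Z\<in>\<Z>. P Z \<subseteq> polynomial_functions d n \<and> Z = zero_locus d n (P Z)" ..
  then have P: "P Z \<subseteq> polynomial_functions d n" and Z: "Z = zero_locus d n (P Z)"
    if "Z \<in> \<Z>" for Z using that by simp_all
  have mem: "As \<in> Z \<longleftrightarrow> As \<in> mat_tuples d n \<and> (\<forall>p\<in>P Z. p As = 0)" if "Z \<in> \<Z>" for Z As
    by (subst Z[OF that]) (simp add: zero_locus_def)
  have "mat_tuples d n \<inter> \<Inter>\<Z> = zero_locus d n (\<Union>Z\<in>\<Z>. P Z)"
    by (auto simp: zero_locus_def mem)
  moreover have "(\<Union>Z\<in>\<Z>. P Z) \<subseteq> polynomial_functions d n"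
    using P by (rule UN_least)
  ultimately show ?thesis unfolding zariski_closed_def
    by (intro exI[of _ "\<Union>Z\<in>\<Z>. P Z"] conjI)
qed

lemma istopology_zariski:
  "istopology (\<lambda>U. U \<subseteq> mat_tuples d n \<and> zariski_closed d n (mat_tuples d n - U))"
  unfolding istopology_def
proof (intro conjI allI impI)
  fix S T :: "'a mat list set"
  assume S: "S \<subseteq> mat_tuples d n \<and> zariski_closed d n (mat_tuples d n - S)"
    and T: "T \<subseteq> mat_tuples d n \<and> zariski_closed d n (mat_tuples d n - T)"
  show "S \<inter> T \<subseteq> mat_tuples d n" using S by blast
  show "zariski_closed d n (mat_tuples d n - S \<inter> T)"
    unfolding Diff_Int by (rule zariski_closed_Un) (use S T in auto)
next
  fix \<K> :: "'a mat list set set"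
  assume K: "\<forall>K\<in>\<K>. K \<subseteq> mat_tuples d n \<and> zariski_closed d n (mat_tuples d n - K)"
  then show "\<Union>\<K> \<subseteq> mat_tuples d n" by blast
  have "mat_tuples d n - \<Union>\<K> = mat_tuples d n \<inter> \<Inter>((\<lambda>K. mat_tuples d n - K) ` \<K>)"
    by blast
  moreover have "zariski_closed d n (mat_tuples d n \<inter> \<Inter>((\<lambda>K. mat_tuples d n - K) ` \<K>))"
    by (rule zariski_closed_Inter) (use K in blast)
  ultimately show "zariski_closed d n (mat_tuples d n - \<Union>\<K>)" by simp
qed

lemma openin_zariski_topology:
  "openin (zariski_topology d n) U \<longleftrightarrow>
     U \<subseteq> mat_tuples d n \<and> zariski_closed d n (mat_tuples d n - U)"
  unfolding zariski_topology_def by (simp add: istopology_zariski)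

lemma topspace_zariski_topology: "topspace (zariski_topology d n) = mat_tuples d n"
proof -
  have "zero_locus d n {\<lambda>_. 1} = ({} :: 'a mat list set)"
    unfolding zero_locus_def by simp
  then have "zariski_closed d n ({} :: 'a mat list set)"
    unfolding zariski_closed_def
    by (intro exI[of _ "{\<lambda>_. 1}"]) (simp add: polynomial_functions.const)
  then have "openin (zariski_topology d n) (mat_tuples d n :: 'a mat list set)"
    by (simp add: openin_zariski_topology)
  then have "mat_tuples d n \<subseteq> topspace (zariski_topology d n :: 'a mat list topology)"
    by (rule openin_subset)
  moreover have "topspace (zariski_topology d n :: 'a mat list topology) \<subseteq> mat_tuples d n"
    using openin_topspace openin_zariski_topology by blast
  ultimately show ?thesis by (rule subset_antisym[rotated])
qed

lemma closedin_zariski_topology: "closedin (zariski_topology d n) Z \<longleftrightarrow> zariski_closed d n Z"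
proof -
  have "Z \<subseteq> mat_tuples d n" if "zariski_closed d n Z"
    using that unfolding zariski_closed_def zero_locus_def by blast
  then show ?thesis
    unfolding closedin_def topspace_zariski_topology openin_zariski_topology
    by (auto simp: double_diff)
qed

definition irreducible_space :: "'a topology \<Rightarrow> bool" where
  "irreducible_space X \<longleftrightarrow> topspace X \<noteq> {} \<and>
     (\<forall>Y Z. closedin X Y \<and> closedin X Z \<and> Y \<union> Z = topspace X \<longrightarrow>
        Y = topspace X \<or> Z = topspace X)"

definition nilpotent_mat :: "nat \<Rightarrow> 'a::field mat \<Rightarrow> bool" where
  "nilpotent_mat n A \<longleftrightarrow> A \<in> carrier_mat n n \<and> (\<exists>k. A ^\<^sub>m k = 0\<^sub>m n n)"

definition commuting_nilpotent_tuples :: "nat \<Rightarrow> nat \<Rightarrow> 'a::field mat list set" where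
  "commuting_nilpotent_tuples d n = {As \<in> mat_tuples d n.
     (\<forall>A\<in>set As. nilpotent_mat n A) \<and> (\<forall>A\<in>set As. \<forall>B\<in>set As. A * B = B * A)}"

text \<open>The set above contains the zero tuple, so its reducibility is never due to emptiness.\<close>

lemma zero_in_commuting_nilpotent_tuples:
  "replicate d (0\<^sub>m n n) \<in> commuting_nilpotent_tuples d n"
proof -
  have "(0\<^sub>m n n :: 'a mat) ^\<^sub>m 1 = 0\<^sub>m n n" by simp
  then have "\<exists>k. (0\<^sub>m n n :: 'a mat) ^\<^sub>m k = 0\<^sub>m n n" by (rule exI)
  then show ?thesis
    by (auto simp: commuting_nilpotent_tuples_def nilpotent_mat_def mat_tuples_def)
qed

end

theory Submission
  imports Defs "Jordan_Normal_Form.Determinant"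
begin

text \<open>
  If \<open>A\<^sub>1\<^bsup>n-1\<^esup> \<noteq> 0\<close>, then every nilpotent matrix commuting with \<open>A\<^sub>1\<close> is a
  polynomial in \<open>A\<^sub>1\<close> without constant term, so any \<open>n\<close> such matrices are linearly dependent.
  On the other hand there are commuting nilpotent matrices \<open>A\<^sub>1, \<dots>, A\<^sub>4\<close> for which the
  \<open>n\<close> matrices \<open>A\<^sub>1, A\<^sub>1\<^sup>2, \<dots>, A\<^sub>1\<^bsup>n-3\<^esup>, A\<^sub>2, A\<^sub>3, A\<^sub>4\<close> are linearly
  independent. So \<open>A\<^sub>1\<^bsup>n-1\<^esup> \<noteq> 0\<close> and the independence of these \<open>n\<close> matrices define
  two disjoint nonempty open sets.
\<close>

section \<open>Nilpotent matrices commuting with a regular nilpotent matrix\<close>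

lemma pow_mat_add:
  assumes "A \<in> carrier_mat n n"
  shows "A ^\<^sub>m (k + l) = A ^\<^sub>m k * (A ^\<^sub>m l :: 'a::semiring_1 mat)"
proof (induction l)
  case 0
  then show ?case using assms by simp
next
  case (Suc l)
  then show ?case
    using assms by (simp add: assoc_mult_mat[of _ n n _ n _ n] pow_carrier_mat)
qed

lemma commute_pow_mat:
  assumes A: "A \<in> carrier_mat n n" and B: "B \<in> carrier_mat n n" and AB: "A * B = B * A"
  shows "A ^\<^sub>m k * B = B * (A ^\<^sub>m k :: 'a::semiring_1 mat)"
proof (induction k)
  case 0
  then show ?case using A B by simp
next
  case (Suc k)
  have [simp]: "A ^\<^sub>m k \<in> carrier_mat n n" using A by (rule pow_carrier_mat)
  have "A ^\<^sub>m Suc k * B = A ^\<^sub>m k * (A * B)"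
    using A B by (simp add: assoc_mult_mat[of _ n n _ n _ n])
  also have "\<dots> = (A ^\<^sub>m k * B) * A"
    unfolding AB using A B by (simp add: assoc_mult_mat[of _ n n _ n _ n])
  also have "\<dots> = B * A ^\<^sub>m Suc k"
    unfolding Suc using A B by (simp add: assoc_mult_mat[of _ n n _ n _ n])
  finally show ?case .
qed

lemma nilpotent_mat_pow:
  assumes "nilpotent_mat n A" "k > 0"
  shows "nilpotent_mat n (A ^\<^sub>m k)"
proof -
  obtain l where A: "A \<in> carrier_mat n n" and l: "A ^\<^sub>m l = 0\<^sub>m n n"
    using assms(1) by (auto simp: nilpotent_mat_def)
  have "(A ^\<^sub>m k) ^\<^sub>m l = A ^\<^sub>m (k * l)"
    using A by (induction l) (simp_all add: pow_mat_add[OF A, symmetric] add.commute)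
  also have "k * l = (k * l - l) + l"
    using assms(2) by simp
  also have "A ^\<^sub>m \<dots> = 0\<^sub>m n n"
    using A by (simp add: pow_mat_add[OF A] l pow_carrier_mat)
  finally show ?thesis
    using A by (auto simp: nilpotent_mat_def pow_carrier_mat)
qed

lemma nonzero_mult_mat_vec:
  assumes "A \<in> carrier_mat n m" "A \<noteq> 0\<^sub>m n m"
  obtains v :: "'a::semiring_1 vec" where "v \<in> carrier_vec m" "A *\<^sub>v v \<noteq> 0\<^sub>v n"
proof -
  obtain i j where ij: "i < n" "j < m" "A $$ (i, j) \<noteq> 0"
    using assms by (metis carrier_matD eq_matI index_zero_mat)
  have "(A *\<^sub>v unit_vec m j) $ i = A $$ (i, j)"
    using assms ij by simp
  then show thesis
    using ij by (intro that[of "unit_vec m j"]) auto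
qed

lemma mult_mat_zero_vec:
  "A \<in> carrier_mat n m \<Longrightarrow> A *\<^sub>v 0\<^sub>v m = (0\<^sub>v n :: 'a::semiring_1 vec)"
  by (intro eq_vecI) (auto simp: scalar_prod_def)

lemma zero_mat_mult_vec:
  "v \<in> carrier_vec m \<Longrightarrow> 0\<^sub>m n m *\<^sub>v v = (0\<^sub>v n :: 'a::semiring_1 vec)"
  by (intro eq_vecI) (auto simp: scalar_prod_def)

lemma index_mult_mat_col:
  "A \<in> carrier_mat n m \<Longrightarrow> B \<in> carrier_mat m k \<Longrightarrow> p < n \<Longrightarrow> r < k \<Longrightarrow>
    (A * B) $$ (p, r) = (A *\<^sub>v col B r) $ p"
  by simp

lemma col_mat_of_vecs:
  "f r \<in> carrier_vec n \<Longrightarrow> r < m \<Longrightarrow> col (mat n m (\<lambda>(p, r). f r $ p)) r = f r"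
  by (intro eq_vecI) auto

text \<open>Take \<open>v\<close> outside the kernel of the last nonzero power \<open>A^m\<close>.
  In a relation between \<open>v, A v, ...\<close> whose first nonzero coefficient has index
  \<open>j\<close>, applying \<open>A^(m-j)\<close> leaves only the \<open>j\<close>-th term:
  earlier coefficients are zero, later exponents exceed \<open>m\<close>. Only
  \<open>m >= n - 1\<close> enters, so no bound \<open>A^n = 0\<close> is invoked.\<close>

lemma nilpotent_mat_cyclic_vector:
  fixes A :: "'a::field mat"
  assumes nil: "nilpotent_mat n A" and ne: "A ^\<^sub>m (n - 1) \<noteq> 0\<^sub>m n n"
  obtains v m where "v \<in> carrier_vec n" "A ^\<^sub>m Suc m = 0\<^sub>m n n" "A ^\<^sub>m m *\<^sub>v v \<noteq> 0\<^sub>v n"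
    "det (mat n n (\<lambda>(i, j). (A ^\<^sub>m j *\<^sub>v v) $ i)) \<noteq> 0"
proof -
  have A: "A \<in> carrier_mat n n" using nil by (simp add: nilpotent_mat_def)
  note pc = pow_carrier_mat[OF A]
  define k where "k = (LEAST k. A ^\<^sub>m k = 0\<^sub>m n n)"
  have k: "A ^\<^sub>m k = 0\<^sub>m n n"
    unfolding k_def by (rule LeastI_ex) (use nil in \<open>simp add: nilpotent_mat_def\<close>)
  have least: "A ^\<^sub>m j \<noteq> 0\<^sub>m n n" if "j < k" for j
    using not_less_Least that unfolding k_def by blast
  have zero: "A ^\<^sub>m j = 0\<^sub>m n n" if "j \<ge> k" for j
    using pow_mat_add[OF A, of k "j - k"] that k left_mult_zero_mat[OF pc] by simp
  have kn: "k > n - 1" using zero ne not_less by blast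
  define m where "m = k - 1"
  have m: "k = Suc m" "n \<le> Suc m" using kn by (auto simp: m_def)
  obtain v where v: "v \<in> carrier_vec n" "A ^\<^sub>m m *\<^sub>v v \<noteq> 0\<^sub>v n"
    using nonzero_mult_mat_vec[OF pc least] m by blast
  define P where "P = mat n n (\<lambda>(i, j). (A ^\<^sub>m j *\<^sub>v v) $ i)"
  have P: "P \<in> carrier_mat n n" by (simp add: P_def)
  have "det P \<noteq> 0"
  proof
    assume "det P = 0"
    then obtain w where w: "w \<in> carrier_vec n" "w \<noteq> 0\<^sub>v n" "P *\<^sub>v w = 0\<^sub>v n"
      using det_0_iff_vec_prod_zero_field[OF P] by blast
    define j where "j = (LEAST j. j < n \<and> w $ j \<noteq> 0)"
    have "\<exists>j. j < n \<and> w $ j \<noteq> 0"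
      using w(1,2) by (metis carrier_vecD eq_vecI index_zero_vec)
    then have j: "j < n" "w $ j \<noteq> 0"
      using LeastI_ex[of "\<lambda>j. j < n \<and> w $ j \<noteq> 0"] by (auto simp: j_def)
    have below: "w $ i = 0" if "i < j" for i
      using not_less_Least[of i "\<lambda>j. j < n \<and> w $ j \<noteq> 0"] that j by (auto simp: j_def)
    \<comment> \<open>Here \<open>m >= n - 1\<close> enters; it keeps the exponent
      \<open>m - j\<close> from being truncated.\<close>
    have jm: "j \<le> m" using j m by linarith
    have "A ^\<^sub>m (m - j) * P = mat n n (\<lambda>(p, i). (A ^\<^sub>m (m - j + i) *\<^sub>v v) $ p)" (is "_ = ?R")
    proof (rule eq_matI)
      fix p i assume "p < dim_row ?R" "i < dim_col ?R"
      then have pi: "p < n" "i < n" by auto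
      have "col P i = A ^\<^sub>m i *\<^sub>v v"
        unfolding P_def by (rule col_mat_of_vecs) (use pi mult_mat_vec_carrier[OF pc v(1)] in simp_all)
      then have "(A ^\<^sub>m (m - j) * P) $$ (p, i) = (A ^\<^sub>m (m - j) *\<^sub>v (A ^\<^sub>m i *\<^sub>v v)) $ p"
        using index_mult_mat_col[OF pc P pi] by simp
      then show "(A ^\<^sub>m (m - j) * P) $$ (p, i) = ?R $$ (p, i)"
        using pi by (simp add: pow_mat_add[OF A] assoc_mult_mat_vec[OF pc pc v(1)])
    qed (use A P in auto)
    moreover have "A ^\<^sub>m (m - j) * P *\<^sub>v w = 0\<^sub>v n"
      using assoc_mult_mat_vec[OF pc P w(1)] w(3) mult_mat_zero_vec[OF pc] by simp
    ultimately have R: "?R *\<^sub>v w = 0\<^sub>v n" by simp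
    have "w $ j * (A ^\<^sub>m m *\<^sub>v v) $ p = 0" if p: "p < n" for p
    proof -
      have "0 = (?R *\<^sub>v w) $ p" using R p by simp
      also have "\<dots> = (\<Sum>i<n. (A ^\<^sub>m (m - j + i) *\<^sub>v v) $ p * w $ i)"
        using p w(1) by (simp add: scalar_prod_def lessThan_atLeast0)
      also have "\<dots> = (\<Sum>i<n. if i = j then (A ^\<^sub>m m *\<^sub>v v) $ p * w $ i else 0)"
      proof (rule sum.cong)
        fix i assume "i \<in> {..<n}"
        consider "i < j" | "i = j" | "i > j" by linarith
        then show "(A ^\<^sub>m (m - j + i) *\<^sub>v v) $ p * w $ i =
            (if i = j then (A ^\<^sub>m m *\<^sub>v v) $ p * w $ i else 0)"
        proof cases
          case 3
          then have "A ^\<^sub>m (m - j + i) = 0\<^sub>m n n"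
            using jm m by (intro zero) linarith
          then show ?thesis using 3 p v(1) by simp
        qed (use below jm in auto)
      qed simp
      finally show ?thesis using j by (simp add: mult.commute)
    qed
    then have "A ^\<^sub>m m *\<^sub>v v = 0\<^sub>v n"
      using j(2) A by (intro eq_vecI) auto
    then show False using v(2) by simp
  qed
  then show thesis
    using that v k m unfolding P_def by blast
qed

text \<open>Expand \<open>B v\<close> in the basis \<open>A^i v\<close> with coordinates
  \<open>c\<close>. Applying \<open>A^m\<close> keeps only the constant coefficient, giving
  \<open>A^m B v = c0 w\<close> with \<open>w = A^m v\<close>. As \<open>B\<close> commutes with
  \<open>A^m\<close>, this says \<open>B w = c0 w\<close>, and a nilpotent \<open>B\<close> has no
  nonzero eigenvalue.\<close>

lemma commuting_nilpotent_mat_kills: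
  fixes A :: "'a::field mat"
  assumes A: "A \<in> carrier_mat n n" and v: "v \<in> carrier_vec n"
    and m: "A ^\<^sub>m Suc m = 0\<^sub>m n n" "A ^\<^sub>m m *\<^sub>v v \<noteq> 0\<^sub>v n"
    and det: "det (mat n n (\<lambda>(i, j). (A ^\<^sub>m j *\<^sub>v v) $ i)) \<noteq> 0"
    and nil: "nilpotent_mat n B" and AB: "A * B = B * A"
  shows "A ^\<^sub>m m *\<^sub>v (B *\<^sub>v v) = 0\<^sub>v n"
proof -
  note pc = pow_carrier_mat[OF A]
  define P where "P = mat n n (\<lambda>(i, j). (A ^\<^sub>m j *\<^sub>v v) $ i)"
  define w where "w = A ^\<^sub>m m *\<^sub>v v"
  have P: "P \<in> carrier_mat n n" by (simp add: P_def)
  have w: "w \<in> carrier_vec n" using pc[of m] v by (auto simp: w_def)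
  obtain k where B: "B \<in> carrier_mat n n" and k: "B ^\<^sub>m k = 0\<^sub>m n n"
    using nil by (auto simp: nilpotent_mat_def)
  have Bv: "B *\<^sub>v v \<in> carrier_vec n" using B v by auto
  obtain P' where P': "P' \<in> carrier_mat n n" "P * P' = 1\<^sub>m n"
    using det_non_zero_imp_unit[OF P, of "TYPE('a)"] det
    by (auto simp: P_def Units_def ring_mat_def)
  define c where "c = P' *\<^sub>v (B *\<^sub>v v)"
  have c: "c \<in> carrier_vec n" using P' Bv by (auto simp: c_def)
  have Pc: "P *\<^sub>v c = B *\<^sub>v v"
    unfolding c_def using assoc_mult_mat_vec[OF P P'(1) Bv] P'(2) Bv by simp
  obtain p where p: "p < n" "w $ p \<noteq> 0"
    using m(2) w unfolding w_def[symmetric] by (metis carrier_vecD eq_vecI index_zero_vec)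
  have Bw: "B *\<^sub>v w = A ^\<^sub>m m *\<^sub>v (B *\<^sub>v v)"
    unfolding w_def using assoc_mult_mat_vec[OF B pc v] assoc_mult_mat_vec[OF pc B v]
      commute_pow_mat[OF A B AB] by metis
  \<comment> \<open>Column \<open>i\<close> is \<open>A^(m+i) v\<close>, which vanishes for
    \<open>i > 0\<close>.\<close>
  have AP: "A ^\<^sub>m m * P = mat n n (\<lambda>(p, i). if i = 0 then w $ p else 0)" (is "_ = ?R")
  proof (rule eq_matI)
    fix p i assume "p < dim_row ?R" "i < dim_col ?R"
    then have pi: "p < n" "i < n" by auto
    have "col P i = A ^\<^sub>m i *\<^sub>v v"
      unfolding P_def by (rule col_mat_of_vecs) (use pi mult_mat_vec_carrier[OF pc v] in simp_all)
    then have "(A ^\<^sub>m m * P) $$ (p, i) = (A ^\<^sub>m (m + i) *\<^sub>v v) $ p"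
      using index_mult_mat_col[OF pc P pi]
      by (simp add: pow_mat_add[OF A] assoc_mult_mat_vec[OF pc pc v])
    moreover have "A ^\<^sub>m (m + i) = 0\<^sub>m n n" if "i > 0"
      using pow_mat_add[OF A, of "Suc m" "i - 1"] that m(1) left_mult_zero_mat[OF pc] by simp
    ultimately show "(A ^\<^sub>m m * P) $$ (p, i) = ?R $$ (p, i)"
      using pi v by (cases "i = 0") (auto simp: w_def)
  qed (use A P in auto)
  have eig: "B *\<^sub>v w = c $ 0 \<cdot>\<^sub>v w"
  proof -
    have "B *\<^sub>v w = A ^\<^sub>m m * P *\<^sub>v c"
      unfolding Bw Pc[symmetric] using assoc_mult_mat_vec[OF pc P c] by simp
    also have "\<dots> = c $ 0 \<cdot>\<^sub>v w"
    proof (rule eq_vecI)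
      fix p assume "p < dim_vec (c $ 0 \<cdot>\<^sub>v w)"
      then have "p < n" using w by simp
      then have "(A ^\<^sub>m m * P *\<^sub>v c) $ p = (\<Sum>i<n. (if i = 0 then w $ p else 0) * c $ i)"
        unfolding AP using c by (simp add: scalar_prod_def lessThan_atLeast0)
      also have "\<dots> = (\<Sum>i<n. if i = 0 then w $ p * c $ i else 0)"
        by (intro sum.cong) auto
      also have "\<dots> = w $ p * c $ 0"
        using p by simp
      finally show "(A ^\<^sub>m m * P *\<^sub>v c) $ p = (c $ 0 \<cdot>\<^sub>v w) $ p"
        using w \<open>p < n\<close> by (simp add: mult.commute)
    qed (use AP w in simp)
    finally show ?thesis .
  qed
  have "B ^\<^sub>m l *\<^sub>v w = c $ 0 ^ l \<cdot>\<^sub>v w" for l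
  proof (induction l)
    case 0
    then show ?case using B w by simp
  next
    case (Suc l)
    have "B ^\<^sub>m Suc l *\<^sub>v w = B ^\<^sub>m l *\<^sub>v (c $ 0 \<cdot>\<^sub>v w)"
      using assoc_mult_mat_vec[OF pow_carrier_mat[OF B] B w] eig by simp
    also have "\<dots> = c $ 0 ^ Suc l \<cdot>\<^sub>v w"
      using mult_mat_vec[OF pow_carrier_mat[OF B] w] Suc by (simp add: smult_smult_assoc)
    finally show ?case .
  qed
  from this[of k] have "c $ 0 ^ k \<cdot>\<^sub>v w = 0\<^sub>v n" using k zero_mat_mult_vec[OF w] by simp
  then have "c $ 0 ^ k * w $ p = 0"
    using w p by (metis carrier_vecD index_smult_vec(1) index_zero_vec(1))
  then have "c $ 0 = 0" using p by auto
  then show ?thesis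
    using eig w unfolding Bw by auto
qed

text \<open>Turns a kernel vector of the matrix with columns \<open>B r v\<close> into a combination
  of the matrices that kills \<open>v\<close>; both sides are the same double sum.\<close>

lemma mult_mat_vec_lincomb:
  fixes B :: "nat \<Rightarrow> 'a::comm_ring_1 mat"
  assumes B: "\<And>r. r < n \<Longrightarrow> B r \<in> carrier_mat n n" and a: "a \<in> carrier_vec n"
    and v: "v \<in> carrier_vec n"
  shows "mat n n (\<lambda>(p, q). \<Sum>r<n. a $ r * B r $$ (p, q)) *\<^sub>v v =
    mat n n (\<lambda>(p, r). (B r *\<^sub>v v) $ p) *\<^sub>v a"
proof (rule eq_vecI)
  fix p assume "p < dim_vec (mat n n (\<lambda>(p, r). (B r *\<^sub>v v) $ p) *\<^sub>v a)"
  then have p: "p < n" by simp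
  have Bv: "(B r *\<^sub>v v) $ p = (\<Sum>q<n. B r $$ (p, q) * v $ q)" if "r < n" for r
    using B[OF that] v p by (simp add: scalar_prod_def lessThan_atLeast0)
  have "(mat n n (\<lambda>(p, q). \<Sum>r<n. a $ r * B r $$ (p, q)) *\<^sub>v v) $ p =
      (\<Sum>q<n. \<Sum>r<n. a $ r * B r $$ (p, q) * v $ q)"
    using p v by (simp add: scalar_prod_def lessThan_atLeast0 sum_distrib_right)
  also have "\<dots> = (\<Sum>r<n. \<Sum>q<n. a $ r * B r $$ (p, q) * v $ q)"
    by (rule sum.swap)
  also have "\<dots> = (\<Sum>r<n. (B r *\<^sub>v v) $ p * a $ r)"
    by (intro sum.cong) (simp_all add: Bv sum_distrib_left sum_distrib_right mult_ac)
  also have "\<dots> = (mat n n (\<lambda>(p, r). (B r *\<^sub>v v) $ p) *\<^sub>v a) $ p"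
    using p a by (simp add: scalar_prod_def lessThan_atLeast0)
  finally show "(mat n n (\<lambda>(p, q). \<Sum>r<n. a $ r * B r $$ (p, q)) *\<^sub>v v) $ p =
      (mat n n (\<lambda>(p, r). (B r *\<^sub>v v) $ p) *\<^sub>v a) $ p" .
qed simp

text \<open>All \<open>B r v\<close> lie in the kernel of \<open>A^m\<close>, a proper subspace, so
  they satisfy a linear relation \<open>a\<close>. The combination \<open>S\<close> of the
  \<open>B r\<close> with these coefficients kills \<open>v\<close>, hence by commutation the whole
  basis \<open>A^j v\<close>, so \<open>S = 0\<close>. No polynomial in \<open>A\<close> has to be
  exhibited.\<close>

lemma regular_nilpotent_commutant_dependent:
  fixes A :: "'a::field mat"
  assumes nilA: "nilpotent_mat n A" and ne: "A ^\<^sub>m (n - 1) \<noteq> 0\<^sub>m n n"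
    and nil: "\<And>r. r < n \<Longrightarrow> nilpotent_mat n (B r)"
    and comm: "\<And>r. r < n \<Longrightarrow> A * B r = B r * A"
  shows "\<exists>a\<in>carrier_vec n. a \<noteq> 0\<^sub>v n \<and> (\<forall>p<n. \<forall>q<n. (\<Sum>r<n. a $ r * B r $$ (p, q)) = 0)"
proof -
  have A: "A \<in> carrier_mat n n" using nilA by (simp add: nilpotent_mat_def)
  have B: "B r \<in> carrier_mat n n" if "r < n" for r
    using nil[OF that] by (simp add: nilpotent_mat_def)
  note pc = pow_carrier_mat[OF A]
  obtain v m where v: "v \<in> carrier_vec n" and m: "A ^\<^sub>m Suc m = 0\<^sub>m n n" "A ^\<^sub>m m *\<^sub>v v \<noteq> 0\<^sub>v n"
    and det: "det (mat n n (\<lambda>(i, j). (A ^\<^sub>m j *\<^sub>v v) $ i)) \<noteq> 0"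
    using nilpotent_mat_cyclic_vector[OF nilA ne] by blast
  define Q where "Q = mat n n (\<lambda>(p, r). (B r *\<^sub>v v) $ p)"
  have Q: "Q \<in> carrier_mat n n" by (simp add: Q_def)
  have "A ^\<^sub>m m * Q = 0\<^sub>m n n"
  proof (rule eq_matI)
    fix p r assume "p < dim_row (0\<^sub>m n n :: 'a mat)" "r < dim_col (0\<^sub>m n n :: 'a mat)"
    then have pr: "p < n" "r < n" by auto
    have "col Q r = B r *\<^sub>v v"
      unfolding Q_def by (rule col_mat_of_vecs) (use pr mult_mat_vec_carrier[OF B v] in simp_all)
    then have "(A ^\<^sub>m m * Q) $$ (p, r) = (A ^\<^sub>m m *\<^sub>v (B r *\<^sub>v v)) $ p"
      using index_mult_mat_col[OF pc Q pr] by simp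
    then show "(A ^\<^sub>m m * Q) $$ (p, r) = 0\<^sub>m n n $$ (p, r)"
      using commuting_nilpotent_mat_kills[OF A v m det nil comm] pr by simp
  qed (use A Q in auto)
  have "det Q = 0"
  proof (rule ccontr)
    assume "det Q \<noteq> 0"
    then obtain Q' where Q': "Q' \<in> carrier_mat n n" "Q * Q' = 1\<^sub>m n"
      using det_non_zero_imp_unit[OF Q, of "TYPE('a)"] by (auto simp: Units_def ring_mat_def)
    have "A ^\<^sub>m m = A ^\<^sub>m m * (Q * Q')"
      using Q' right_mult_one_mat[OF pc] by simp
    also have "\<dots> = 0\<^sub>m n n"
      by (simp only: assoc_mult_mat[OF pc Q Q'(1), symmetric] \<open>A ^\<^sub>m m * Q = 0\<^sub>m n n\<close>
          left_mult_zero_mat[OF Q'(1)])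
    finally show False using m(2) zero_mat_mult_vec[OF v] by simp
  qed
  then obtain a where a: "a \<in> carrier_vec n" "a \<noteq> 0\<^sub>v n" "Q *\<^sub>v a = 0\<^sub>v n"
    using det_0_iff_vec_prod_zero_field[OF Q] by blast
  define S where "S = mat n n (\<lambda>(p, q). \<Sum>r<n. a $ r * B r $$ (p, q))"
  have S: "S \<in> carrier_mat n n" by (simp add: S_def)
  define P where "P = mat n n (\<lambda>(i, j). (A ^\<^sub>m j *\<^sub>v v) $ i)"
  have P: "P \<in> carrier_mat n n" by (simp add: P_def)
  \<comment> \<open>Pulling \<open>A^j\<close> past each \<open>B r\<close> gives
    \<open>S A^j v = A^j Q a = 0\<close>.\<close>
  have SA: "S *\<^sub>v (A ^\<^sub>m j *\<^sub>v v) = 0\<^sub>v n" for j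
  proof -
    have Ajv: "A ^\<^sub>m j *\<^sub>v v \<in> carrier_vec n" using pc[of j] v by auto
    have "S *\<^sub>v (A ^\<^sub>m j *\<^sub>v v) = mat n n (\<lambda>(p, r). (B r *\<^sub>v (A ^\<^sub>m j *\<^sub>v v)) $ p) *\<^sub>v a"
      unfolding S_def by (rule mult_mat_vec_lincomb[OF B a(1) Ajv])
    also have "mat n n (\<lambda>(p, r). (B r *\<^sub>v (A ^\<^sub>m j *\<^sub>v v)) $ p) = A ^\<^sub>m j * Q" (is "?L = _")
    proof (rule eq_matI)
      fix p r assume "p < dim_row (A ^\<^sub>m j * Q)" "r < dim_col (A ^\<^sub>m j * Q)"
      then have pr: "p < n" "r < n" using pc[of j] Q by auto
      have "col Q r = B r *\<^sub>v v"
        unfolding Q_def by (rule col_mat_of_vecs) (use pr mult_mat_vec_carrier[OF B v] in simp_all)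
      moreover have "B r *\<^sub>v (A ^\<^sub>m j *\<^sub>v v) = A ^\<^sub>m j *\<^sub>v (B r *\<^sub>v v)"
        using assoc_mult_mat_vec[OF B pc v] assoc_mult_mat_vec[OF pc B v]
          commute_pow_mat[OF A B comm] pr by metis
      ultimately show "?L $$ (p, r) = (A ^\<^sub>m j * Q) $$ (p, r)"
        using index_mult_mat_col[OF pc Q pr] pr by simp
    qed (use A Q in auto)
    also have "A ^\<^sub>m j * Q *\<^sub>v a = 0\<^sub>v n"
      using assoc_mult_mat_vec[OF pc Q a(1)] a(3) mult_mat_zero_vec[OF pc] by simp
    finally show ?thesis .
  qed
  have SP: "S * P = 0\<^sub>m n n"
  proof (rule eq_matI)
    fix p j assume "p < dim_row (0\<^sub>m n n :: 'a mat)" "j < dim_col (0\<^sub>m n n :: 'a mat)"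
    then have pj: "p < n" "j < n" by auto
    have "col P j = A ^\<^sub>m j *\<^sub>v v"
      unfolding P_def by (rule col_mat_of_vecs) (use pj mult_mat_vec_carrier[OF pc v] in simp_all)
    then have "(S * P) $$ (p, j) = (S *\<^sub>v (A ^\<^sub>m j *\<^sub>v v)) $ p"
      using index_mult_mat_col[OF S P pj] by simp
    then show "(S * P) $$ (p, j) = 0\<^sub>m n n $$ (p, j)"
      using SA pj by simp
  qed (use S P in auto)
  obtain P' where P': "P' \<in> carrier_mat n n" "P * P' = 1\<^sub>m n"
    using det_non_zero_imp_unit[OF P, of "TYPE('a)"] det
    by (auto simp: P_def Units_def ring_mat_def)
  have "S = S * (P * P')" using P' S by simp
  also have "\<dots> = 0\<^sub>m n n"
    using assoc_mult_mat[OF S P P'(1)] SP P' by simp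
  finally have "S $$ (p, q) = 0" if "p < n" "q < n" for p q
    using that by simp
  then show ?thesis
    using a by (intro bexI[of _ a] conjI allI impI) (simp_all add: S_def)
qed

section \<open>Regular functions\<close>

text \<open>
  Agreement is required on \<^const>\<open>mat_tuples\<close> only, since entries of matrix products are given
  by the usual formula only for matrices of matching dimensions.
\<close>

definition regular_fun :: "nat \<Rightarrow> nat \<Rightarrow> ('a::field mat list \<Rightarrow> 'a) \<Rightarrow> bool" where
  "regular_fun d n f \<longleftrightarrow> (\<exists>p\<in>polynomial_functions d n. \<forall>As\<in>mat_tuples d n. f As = p As)"

lemma regular_fun_const: "regular_fun d n (\<lambda>_. c)"
  unfolding regular_fun_def by (intro bexI[OF _ polynomial_functions.const]) auto

lemma regular_fun_coord:
  "k < d \<Longrightarrow> i < n \<Longrightarrow> j < n \<Longrightarrow> regular_fun d n (\<lambda>As. (As ! k) $$ (i, j))"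
  unfolding regular_fun_def by (intro bexI[OF _ polynomial_functions.coord[of k d i n j]]) auto

lemma regular_fun_add:
  assumes "regular_fun d n f" "regular_fun d n g"
  shows "regular_fun d n (\<lambda>As. f As + g As)"
proof -
  obtain p q where "p \<in> polynomial_functions d n" "\<forall>As\<in>mat_tuples d n. f As = p As"
    "q \<in> polynomial_functions d n" "\<forall>As\<in>mat_tuples d n. g As = q As"
    using assms by (auto simp: regular_fun_def)
  then show ?thesis
    unfolding regular_fun_def
    by (intro bexI[OF _ polynomial_functions.add[of p _ _ q]]) auto
qed

lemma regular_fun_mult:
  assumes "regular_fun d n f" "regular_fun d n g"
  shows "regular_fun d n (\<lambda>As. f As * g As)"
proof -
  obtain p q where "p \<in> polynomial_functions d n" "\<forall>As\<in>mat_tuples d n. f As = p As"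
    "q \<in> polynomial_functions d n" "\<forall>As\<in>mat_tuples d n. g As = q As"
    using assms by (auto simp: regular_fun_def)
  then show ?thesis
    unfolding regular_fun_def
    by (intro bexI[OF _ polynomial_functions.mult[of p _ _ q]]) auto
qed

lemma regular_fun_cong:
  assumes "regular_fun d n g" "\<And>As. As \<in> mat_tuples d n \<Longrightarrow> f As = g As"
  shows "regular_fun d n f"
  using assms unfolding regular_fun_def by auto

lemma regular_fun_sum:
  "(\<And>x. x \<in> I \<Longrightarrow> regular_fun d n (f x)) \<Longrightarrow> regular_fun d n (\<lambda>As. \<Sum>x\<in>I. f x As)"
  by (induction I rule: infinite_finite_induct)
    (auto intro: regular_fun_const regular_fun_add)

lemma regular_fun_prod:
  "(\<And>x. x \<in> I \<Longrightarrow> regular_fun d n (f x)) \<Longrightarrow> regular_fun d n (\<lambda>As. \<Prod>x\<in>I. f x As)"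
  by (induction I rule: infinite_finite_induct)
    (auto intro: regular_fun_const regular_fun_mult)

text \<open>By the Leibniz formula; permutations keep the indices below \<open>m\<close>.\<close>

lemma regular_fun_det:
  assumes "\<And>r s. r < m \<Longrightarrow> s < m \<Longrightarrow> regular_fun d n (\<lambda>As. M As r s)"
  shows "regular_fun d n (\<lambda>As. det (mat m m (\<lambda>(r, s). M As r s)))"
proof -
  have "det (mat m m (\<lambda>(r, s). M As r s)) =
      (\<Sum>\<pi>\<in>{\<pi>. \<pi> permutes {0..<m}}. signof \<pi> * (\<Prod>i = 0..<m. M As i (\<pi> i)))" for As
    unfolding det_def by (auto intro!: sum.cong prod.cong)
  moreover have "regular_fun d n (\<lambda>As. \<Sum>\<pi>\<in>{\<pi>. \<pi> permutes {0..<m}}.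
      signof \<pi> * (\<Prod>i = 0..<m. M As i (\<pi> i)))"
    by (intro regular_fun_sum regular_fun_mult regular_fun_const regular_fun_prod assms)
      (auto simp: permutes_in_image)
  ultimately show ?thesis by simp
qed

lemma mat_tuples_nth: "As \<in> mat_tuples d n \<Longrightarrow> k < d \<Longrightarrow> As ! k \<in> carrier_mat n n"
  by (auto simp: mat_tuples_def)

lemma regular_fun_pow_mat:
  assumes "k < d" "i < n" "j < n"
  shows "regular_fun d n (\<lambda>As :: 'a::field mat list. (As ! k ^\<^sub>m l) $$ (i, j))"
  using assms(3)
\<comment> \<open>The column must vary: entry \<open>(i, j)\<close> of the next power uses all
  entries \<open>(i, t)\<close> of the current one. The row stays fixed.\<close>
proof (induction l arbitrary: j)
  case 0
  show ?case
    by (rule regular_fun_cong[OF regular_fun_const[of _ _ "if i = j then 1 else 0"]])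
      (use assms 0 in \<open>auto dest: mat_tuples_nth[OF _ assms(1)]\<close>)
next
  case (Suc l)
  have "regular_fun d n (\<lambda>As :: 'a mat list. \<Sum>t<n. (As ! k ^\<^sub>m l) $$ (i, t) * (As ! k) $$ (t, j))"
    by (intro regular_fun_sum regular_fun_mult regular_fun_coord Suc.IH)
      (use assms Suc.prems in auto)
  then show ?case
  proof (rule regular_fun_cong)
    fix As :: "'a mat list" assume "As \<in> mat_tuples d n"
    then have "As ! k \<in> carrier_mat n n" by (rule mat_tuples_nth[OF _ assms(1)])
    with pow_carrier_mat[OF this, of l]
    show "(As ! k ^\<^sub>m Suc l) $$ (i, j) = (\<Sum>t<n. (As ! k ^\<^sub>m l) $$ (i, t) * (As ! k) $$ (t, j))"
      using assms Suc.prems by (simp add: scalar_prod_def lessThan_atLeast0)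
  qed
qed

text \<open>The zero set is unchanged when each \<open>f\<close> is replaced by a polynomial
  function with the same values on the tuples.\<close>

lemma zariski_closed_regular:
  assumes "\<And>f. f \<in> F \<Longrightarrow> regular_fun d n f"
  shows "zariski_closed d n {As \<in> mat_tuples d n. \<forall>f\<in>F. f As = 0}"
proof -
  have "\<exists>p. \<forall>f\<in>F. p f \<in> polynomial_functions d n \<and> (\<forall>As\<in>mat_tuples d n. f As = p f As)"
    by (intro bchoice) (use assms in \<open>auto simp: regular_fun_def\<close>)
  then obtain p where
    "\<forall>f\<in>F. p f \<in> polynomial_functions d n \<and> (\<forall>As\<in>mat_tuples d n. f As = p f As)" ..
  then show ?thesis
    unfolding zariski_closed_def zero_locus_def by (intro exI[of _ "p ` F"]) auto
qed

section \<open>Two disjoint open sets\<close>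

lemma not_irreducible_subtopologyI:
  assumes "closedin X Y" "closedin X Z" "S \<subseteq> Y \<union> Z" "S \<subseteq> topspace X"
    "x \<in> S" "x \<notin> Y" "y \<in> S" "y \<notin> Z"
  shows "\<not> irreducible_space (subtopology X S)"
proof -
  have "closedin (subtopology X S) (S \<inter> Y)" "closedin (subtopology X S) (S \<inter> Z)"
    using assms by (auto simp: closedin_subtopology)
  moreover have "S \<inter> Y \<union> S \<inter> Z = topspace (subtopology X S)"
    using assms by auto
  ultimately show ?thesis
    using assms unfolding irreducible_space_def by (metis IntD2 topspace_subtopology_subset)
qed

section \<open>Shift matrices, matrix units and the two witness tuples\<close>

text \<open>For \<open>m <= n\<close> this is a nilpotent Jordan block on
  \<open>e_0, ..., e_(m-1)\<close>, sending \<open>e_j\<close> to \<open>e_(j+1)\<close>, padded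
  with zeros to size \<open>n\<close>.\<close>

definition shift_mat :: "nat \<Rightarrow> nat \<Rightarrow> 'a::field mat" where
  "shift_mat n m = mat n n (\<lambda>(i, j). if i = Suc j \<and> i < m then 1 else 0)"

definition elem_mat :: "nat \<Rightarrow> nat \<Rightarrow> nat \<Rightarrow> 'a::field mat" where
  "elem_mat n p q = mat n n (\<lambda>(i, j). if i = p \<and> j = q then 1 else 0)"

lemma shift_mat_carrier: "shift_mat n m \<in> carrier_mat n n"
  by (simp add: shift_mat_def)

lemma elem_mat_carrier: "elem_mat n p q \<in> carrier_mat n n"
  by (simp add: elem_mat_def)

text \<open>Positive exponents only: for \<open>m < n\<close> the zeroth power has diagonal entries
  in rows \<open>i >= m\<close>, which the formula omits.\<close>

lemma shift_mat_pow:
  assumes "m \<le> n"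
  shows "shift_mat n m ^\<^sub>m Suc k =
    (mat n n (\<lambda>(i, j). if i = j + Suc k \<and> i < m then 1 else 0) :: 'a::field mat)"
proof (induction k)
  case 0
  then show ?case using shift_mat_carrier[of n m] by (simp add: shift_mat_def)
next
  case (Suc k)
  have "shift_mat n m ^\<^sub>m Suc (Suc k) =
      mat n n (\<lambda>(i, j). if i = j + Suc k \<and> i < m then 1 else 0) * (shift_mat n m :: 'a mat)"
    using Suc by simp
  also have "\<dots> = mat n n (\<lambda>(i, j). if i = j + Suc (Suc k) \<and> i < m then 1 else 0)" (is "?L = ?R")
  proof (rule eq_matI)
    fix i j assume "i < dim_row ?R" "j < dim_col ?R"
    then have ij: "i < n" "j < n" by auto
    have "?L $$ (i, j) = (\<Sum>t<n. (if i = t + Suc k \<and> i < m then 1 else 0) *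
        (if t = Suc j \<and> t < m then 1 else 0))"
      using ij by (simp add: shift_mat_def scalar_prod_def lessThan_atLeast0)
    also have "\<dots> = (\<Sum>t<n. if t = Suc j then (if i = t + Suc k \<and> i < m then 1 else 0) else 0)"
      by (intro sum.cong) auto
    also have "\<dots> = ?R $$ (i, j)"
      using ij assms by auto
    finally show "?L $$ (i, j) = ?R $$ (i, j)" .
  qed (auto simp: shift_mat_def)
  finally show ?case .
qed

lemma nilpotent_shift_mat:
  assumes "m \<le> n"
  shows "nilpotent_mat n (shift_mat n m :: 'a::field mat)"
proof -
  have "shift_mat n m ^\<^sub>m Suc n = (0\<^sub>m n n :: 'a mat)"
    using assms by (subst shift_mat_pow) (auto intro!: eq_matI)
  then show ?thesis
    using shift_mat_carrier unfolding nilpotent_mat_def by blast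
qed

lemma mult_mat_eq_0I:
  assumes "A \<in> carrier_mat n n" "B \<in> carrier_mat n n"
    "\<And>i t j. i < n \<Longrightarrow> t < n \<Longrightarrow> j < n \<Longrightarrow> A $$ (i, t) * B $$ (t, j) = 0"
  shows "A * B = (0\<^sub>m n n :: 'a::semiring_1 mat)"
  using assms by (intro eq_matI) (auto simp: scalar_prod_def intro!: sum.neutral)

lemma elem_mat_mult_elem_mat:
  "q \<noteq> p' \<Longrightarrow> elem_mat n p q * elem_mat n p' q' = 0\<^sub>m n n"
  by (rule mult_mat_eq_0I) (auto simp: elem_mat_def)

text \<open>Left multiplication by the matrix unit extracts row \<open>q\<close> of the shift, and
  rows \<open>0, m, m + 1, ...\<close> are zero. The next lemma does the same for columns.\<close>

lemma elem_mat_mult_shift_mat: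
  "q = 0 \<or> q \<ge> m \<Longrightarrow> elem_mat n p q * shift_mat n m = 0\<^sub>m n n"
  by (rule mult_mat_eq_0I) (auto simp: elem_mat_def shift_mat_def)

lemma shift_mat_mult_elem_mat:
  "Suc p \<ge> m \<Longrightarrow> shift_mat n m * elem_mat n p q = 0\<^sub>m n n"
  by (rule mult_mat_eq_0I) (auto simp: elem_mat_def shift_mat_def)

lemma nilpotent_elem_mat:
  assumes "p \<noteq> q"
  shows "nilpotent_mat n (elem_mat n p q :: 'a::field mat)"
proof -
  have "elem_mat n p q ^\<^sub>m 2 = (0\<^sub>m n n :: 'a mat)"
    using assms elem_mat_mult_elem_mat[of q p n p q] elem_mat_carrier[of n p q]
    by (simp add: numeral_2_eq_2)
  then show ?thesis
    using elem_mat_carrier unfolding nilpotent_mat_def by blast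
qed

lemma nilpotent_zero_mat: "nilpotent_mat n (0\<^sub>m n n :: 'a::field mat)"
proof -
  have "(0\<^sub>m n n :: 'a mat) ^\<^sub>m 1 = 0\<^sub>m n n" by simp
  then show ?thesis
    unfolding nilpotent_mat_def by (intro conjI zero_carrier_mat exI[of _ 1])
qed

definition jordan_tuple :: "nat \<Rightarrow> nat \<Rightarrow> 'a::field mat list" where
  "jordan_tuple d n = shift_mat n n # replicate (d - 1) (0\<^sub>m n n)"

text \<open>
  The vector space with basis \<open>e\<^sub>0, \<dots>, e\<^bsub>n-1\<^esub>\<close> is a module with the two generators
  \<open>e\<^sub>0\<close> and \<open>e\<^bsub>n-1\<^esub>\<close> over the local algebra with basis
  \<open>1, x, \<dots>, x\<^bsup>n-3\<^esup>, y, z, w\<close>, whose maximal ideal has dimension \<open>n\<close>: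
  \<open>x\<close> moves \<open>e\<^sub>0\<close> along the chain ending in \<open>e\<^bsub>n-3\<^esub>\<close>, and \<open>y, z, w\<close> map a generator
  into the socle, spanned by \<open>e\<^bsub>n-3\<^esub>\<close> and \<open>e\<^bsub>n-2\<^esub>\<close>.
\<close>

definition large_tuple :: "nat \<Rightarrow> nat \<Rightarrow> 'a::field mat list" where
  "large_tuple d n = [shift_mat n (n - 2), elem_mat n (n - 2) 0, elem_mat n (n - 3) (n - 1),
     elem_mat n (n - 2) (n - 1)] @ replicate (d - 4) (0\<^sub>m n n)"

lemma jordan_tuple_in:
  assumes "d \<ge> 1"
  shows "jordan_tuple d n \<in> commuting_nilpotent_tuples d n"
  using assms nilpotent_shift_mat[of n n] nilpotent_zero_mat[of n]
  by (auto simp: commuting_nilpotent_tuples_def mat_tuples_def jordan_tuple_def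
      shift_mat_carrier left_mult_zero_mat[OF shift_mat_carrier]
      right_mult_zero_mat[OF shift_mat_carrier])

text \<open>Different matrices of the tuple have product zero in either order. For
  \<open>elem_mat n (n - 2) 0\<close> times \<open>elem_mat n (n - 3) (n - 1)\<close> this uses
  \<open>n - 3 > 0\<close>, hence \<open>n >= 4\<close>.\<close>

lemma large_tuple_in:
  assumes "d \<ge> 4" "n \<ge> 4"
  shows "large_tuple d n \<in> commuting_nilpotent_tuples d n"
proof -
  note [simp] = shift_mat_carrier elem_mat_carrier
    left_mult_zero_mat[OF shift_mat_carrier] right_mult_zero_mat[OF shift_mat_carrier]
    left_mult_zero_mat[OF elem_mat_carrier] right_mult_zero_mat[OF elem_mat_carrier]
    elem_mat_mult_elem_mat elem_mat_mult_shift_mat shift_mat_mult_elem_mat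
    nilpotent_elem_mat nilpotent_shift_mat nilpotent_zero_mat
  show ?thesis
    using assms
    by (auto simp: commuting_nilpotent_tuples_def mat_tuples_def large_tuple_def)
qed

section \<open>A minor that tests linear independence\<close>

text \<open>The first matrix is \<open>As ! 0\<close>: indices \<open>r < n - 3\<close> give its
  powers with exponents 1 to \<open>n - 3\<close>, the last three give \<open>As ! 1\<close>,
  \<open>As ! 2\<close>, \<open>As ! 3\<close>. Adding 4 before subtracting \<open>n\<close> avoids
  truncation.\<close>

definition gen_mat :: "nat \<Rightarrow> 'a::field mat list \<Rightarrow> nat \<Rightarrow> 'a mat" where
  "gen_mat n As r = (if r < n - 3 then As ! 0 ^\<^sub>m Suc r else As ! (r + 4 - n))"

text \<open>Rows 1 to \<open>n - 2\<close> of column 0, then rows \<open>n - 3\<close> and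
  \<open>n - 2\<close> of the last column: coefficients of the images of the two generators
  \<open>e_0\<close> and \<open>e_(n-1)\<close>.\<close>

definition minor_pos :: "nat \<Rightarrow> nat \<Rightarrow> nat \<times> nat" where
  "minor_pos n s = (if s < n - 2 then (Suc s, 0) else (s - 1, n - 1))"

text \<open>
  A maximal minor of the matrix whose rows are the entries of the \<open>n\<close> matrices
  \<^term>\<open>gen_mat n As r\<close>; the columns are chosen so that \<^const>\<open>large_tuple\<close> gives
  the identity matrix.
\<close>

definition gen_minor :: "nat \<Rightarrow> 'a::field mat list \<Rightarrow> 'a" where
  "gen_minor n As = det (mat n n (\<lambda>(r, s). gen_mat n As r $$ minor_pos n s))"

lemma minor_pos_less:
  assumes "n \<ge> 4" "s < n"
  obtains p q where "minor_pos n s = (p, q)" "p < n" "q < n"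
  using assms by (cases "s < n - 2") (auto simp: minor_pos_def)

text \<open>The power \<open>x^(r+1)\<close> has a single one in column 0, at row
  \<open>r + 1\<close>, and a zero last column; \<open>y\<close>, \<open>z\<close>, \<open>w\<close>
  are the matrix units at the last three positions.\<close>

lemma gen_minor_large_tuple:
  assumes "n \<ge> 4"
  shows "gen_minor n (large_tuple d n :: 'a::field mat list) = 1"
proof -
  have "mat n n (\<lambda>(r, s). gen_mat n (large_tuple d n) r $$ minor_pos n s) = (1\<^sub>m n :: 'a mat)"
  proof (rule eq_matI)
    fix r s assume "r < dim_row (1\<^sub>m n :: 'a mat)" "s < dim_col (1\<^sub>m n :: 'a mat)"
    then have rs: "r < n" "s < n" by auto
    consider "r < n - 3" | "r = n - 3" | "r = n - 2" | "r = n - 1"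
      using rs by linarith
    then have "gen_mat n (large_tuple d n) r $$ minor_pos n s = (if r = s then 1 else 0 :: 'a)"
    proof cases
      case 1
      then have "gen_mat n (large_tuple d n :: 'a mat list) r = shift_mat n (n - 2) ^\<^sub>m Suc r"
        by (simp add: gen_mat_def large_tuple_def)
      also have "\<dots> = mat n n (\<lambda>(i, j). if i = j + Suc r \<and> i < n - 2 then 1 else 0)"
        by (rule shift_mat_pow) simp
      finally show ?thesis using 1 rs assms by (auto simp: minor_pos_def)
    next
      case 2
      then have "r + 4 - n = 1" using assms by simp
      then show ?thesis
        using 2 rs assms by (auto simp: gen_mat_def large_tuple_def elem_mat_def minor_pos_def)
    next
      case 3
      then have "r + 4 - n = 2" using assms by simp
      then show ?thesis
        using 3 rs assms by (auto simp: gen_mat_def large_tuple_def elem_mat_def minor_pos_def)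
    next
      case 4
      then have "r + 4 - n = 3" using assms by simp
      then show ?thesis
        using 4 rs assms by (auto simp: gen_mat_def large_tuple_def elem_mat_def minor_pos_def)
    qed
    then show "mat n n (\<lambda>(r, s). gen_mat n (large_tuple d n) r $$ minor_pos n s) $$ (r, s) =
        (1\<^sub>m n :: 'a mat) $$ (r, s)"
      using rs by simp
  qed auto
  then show ?thesis by (simp add: gen_minor_def)
qed

lemma regular_fun_gen_minor:
  assumes "d \<ge> 4" "n \<ge> 4"
  shows "regular_fun d n (gen_minor n)"
  unfolding gen_minor_def
proof (rule regular_fun_det)
  fix r s assume rs: "r < n" "s < n"
  obtain p q where pq: "minor_pos n s = (p, q)" "p < n" "q < n"
    using minor_pos_less[OF assms(2) rs(2)] by blast
  show "regular_fun d n (\<lambda>As. gen_mat n As r $$ minor_pos n s)"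
  proof (cases "r < n - 3")
    case True
    then show ?thesis
      using regular_fun_pow_mat[of 0 d p n q "Suc r"] pq assms by (simp add: gen_mat_def)
  next
    case False
    \<comment> \<open>The index is at most 3, so \<open>d >= 4\<close> covers it.\<close>
    have "r + 4 - n < d" using rs assms by linarith
    then show ?thesis
      using regular_fun_coord[of "r + 4 - n" d p n q] False pq by (simp add: gen_mat_def)
  qed
qed

text \<open>The \<open>n\<close> matrices \<open>gen_mat n As r\<close> are nilpotent and commute
  with \<open>As ! 0\<close>, so they satisfy a linear relation. Its coefficients give a relation
  between the rows of the minor, hence a kernel vector of the transpose.\<close>

lemma gen_minor_eq_0:
  fixes As :: "'a::field mat list"
  assumes dn: "d \<ge> 4" "n \<ge> 4" and As: "As \<in> commuting_nilpotent_tuples d n"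
    and ne: "As ! 0 ^\<^sub>m (n - 1) \<noteq> 0\<^sub>m n n"
  shows "gen_minor n As = 0"
proof -
  have len: "length As = d" and nil: "\<And>k. k < d \<Longrightarrow> nilpotent_mat n (As ! k)"
    and comm: "\<And>k l. k < d \<Longrightarrow> l < d \<Longrightarrow> As ! k * As ! l = As ! l * As ! k"
    using As by (auto simp: commuting_nilpotent_tuples_def mat_tuples_def)
  have nil0: "nilpotent_mat n (As ! 0)" using nil dn by simp
  then have A0: "As ! 0 \<in> carrier_mat n n" by (simp add: nilpotent_mat_def)
  have gnil: "nilpotent_mat n (gen_mat n As r)" if "r < n" for r
    using that dn nil nilpotent_mat_pow[OF nil0, of "Suc r"] by (simp add: gen_mat_def)
  have gcomm: "As ! 0 * gen_mat n As r = gen_mat n As r * As ! 0" if "r < n" for r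
    using that dn comm commute_pow_mat[OF A0 A0 refl, of "Suc r"] by (simp add: gen_mat_def)
  have "\<exists>a\<in>carrier_vec n. a \<noteq> 0\<^sub>v n \<and>
      (\<forall>p<n. \<forall>q<n. (\<Sum>r<n. a $ r * gen_mat n As r $$ (p, q)) = 0)"
    using nil0 ne gnil gcomm by (rule regular_nilpotent_commutant_dependent)
  then obtain a where a: "a \<in> carrier_vec n" "a \<noteq> 0\<^sub>v n"
    and dep: "\<forall>p<n. \<forall>q<n. (\<Sum>r<n. a $ r * gen_mat n As r $$ (p, q)) = 0"
    by (elim bexE conjE)
  define M where "M = mat n n (\<lambda>(r, s). gen_mat n As r $$ minor_pos n s)"
  have M: "M \<in> carrier_mat n n" by (simp add: M_def)
  have "transpose_mat M *\<^sub>v a = 0\<^sub>v n"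
  proof (rule eq_vecI)
    fix s assume "s < dim_vec (0\<^sub>v n :: 'a vec)"
    then have s: "s < n" by simp
    obtain p q where pq: "minor_pos n s = (p, q)" "p < n" "q < n"
      using minor_pos_less[OF dn(2) s] by blast
    have "(transpose_mat M *\<^sub>v a) $ s = (\<Sum>r<n. a $ r * gen_mat n As r $$ (p, q))"
      using s a(1) pq by (simp add: M_def scalar_prod_def lessThan_atLeast0 mult.commute)
    then show "(transpose_mat M *\<^sub>v a) $ s = 0\<^sub>v n $ s"
      using dep pq s by simp
  qed (simp add: M_def)
  then have "det (transpose_mat M) = 0"
    using a M det_0_iff_vec_prod_zero_field[of "transpose_mat M" n] by auto
  then show ?thesis
    using det_transpose[OF M] by (simp add: gen_minor_def M_def)
qed

theorem theorem10:
  fixes d n :: nat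
  assumes "d \<ge> 4" and "n \<ge> 4"
  shows "\<not> irreducible_space (subtopology (zariski_topology d n)
           (commuting_nilpotent_tuples d n :: 'a::alg_closed_field mat list set))"
proof -
  \<comment> \<open>The entries of the power \<open>n - 1\<close> of the first matrix;
    \<open>Y\<close> is the locus where this power vanishes.\<close>
  define F :: "('a mat list \<Rightarrow> 'a) set" where
    "F = {(\<lambda>As. (As ! 0 ^\<^sub>m (n - 1)) $$ (i, j)) |i j. i < n \<and> j < n}"
  have F: "regular_fun d n f" if "f \<in> F" for f
    using that assms by (auto simp: F_def intro: regular_fun_pow_mat)
  define Y where "Y = {As \<in> mat_tuples d n. \<forall>f\<in>F. f As = 0}"
  define Z where "Z = {As \<in> mat_tuples d n. \<forall>f\<in>{gen_minor n}. f As = (0::'a)}"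
  show ?thesis
  proof (rule not_irreducible_subtopologyI)
    show "closedin (zariski_topology d n) Y"
      unfolding closedin_zariski_topology Y_def by (rule zariski_closed_regular[OF F])
    show "closedin (zariski_topology d n) Z"
      unfolding closedin_zariski_topology Z_def
      by (rule zariski_closed_regular) (use regular_fun_gen_minor[OF assms] in simp)
    show "commuting_nilpotent_tuples d n \<subseteq> topspace (zariski_topology d n :: 'a mat list topology)"
      unfolding topspace_zariski_topology by (auto simp: commuting_nilpotent_tuples_def)
    show "commuting_nilpotent_tuples d n \<subseteq> Y \<union> Z"
    proof
      fix As :: "'a mat list" assume As: "As \<in> commuting_nilpotent_tuples d n"
      then have mt: "As \<in> mat_tuples d n" by (simp add: commuting_nilpotent_tuples_def)
      show "As \<in> Y \<union> Z"
      \<comment> \<open>Outside \<open>Y\<close> the first matrix is regular nilpotent, which forces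
        the minor to vanish.\<close>
      proof (cases "As ! 0 ^\<^sub>m (n - 1) = 0\<^sub>m n n")
        case True
        then show ?thesis using mt by (auto simp: Y_def F_def)
      next
        case False
        then show ?thesis
          using gen_minor_eq_0[OF assms As] mt by (simp add: Z_def)
      qed
    qed
    show "jordan_tuple d n \<in> commuting_nilpotent_tuples d n"
      by (rule jordan_tuple_in) (use assms in simp)
    show "jordan_tuple d n \<notin> Y"
    proof
      assume Y: "jordan_tuple d n \<in> Y"
      \<comment> \<open>This entry is the coefficient of \<open>e_(n-1)\<close> in the image of
        \<open>e_0\<close>; for the full shift it is 1.\<close>
      have "(\<lambda>As. (As ! 0 ^\<^sub>m (n - 1)) $$ (n - 1, 0)) \<in> F"
        unfolding F_def
      proof (intro CollectI exI conjI)
        show "n - 1 < n" "0 < n" using assms by linarith+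
      qed (rule refl)
      moreover have "\<forall>f\<in>F. f (jordan_tuple d n) = 0"
        using Y by (simp add: Y_def)
      ultimately have "(jordan_tuple d n ! 0 ^\<^sub>m (n - 1)) $$ (n - 1, 0) = (0::'a)"
        by (rule bspec[rotated])
      then have "(shift_mat n n ^\<^sub>m (n - 1)) $$ (n - 1, 0) = (0::'a)"
        by (simp add: jordan_tuple_def)
      \<comment> \<open>The formula for powers of the shift expects a successor as exponent.\<close>
      moreover have "n - 1 = Suc (n - 2)" using assms by simp
      ultimately show False
        using shift_mat_pow[of n n "n - 2", where 'a = 'a] assms by (simp split: if_splits)
    qed
    show "large_tuple d n \<in> commuting_nilpotent_tuples d n"
      by (rule large_tuple_in[OF assms])
    show "large_tuple d n \<notin> Z"
      using gen_minor_large_tuple[OF assms(2), of d, where 'a = 'a] by (simp add: Z_def)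
  qed
qed

end
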